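(* Let $p,n\in\mathbb N$ with $p\ge n\ge 15$ and $p=k(n-1)+n-8$ for some $k\in\mathbb N$. Then $$\mathrm{ex}(p;T_n^3)=\frac{(n-2)p-7n+30}2+\max\Big\{\Big\lfloor\frac n2\Big\rfloor,13\Big\}.$$
   Context: All graphs are finite simple graphs. For a graph $L$, $\mathrm{ex}(p;L)$ denotes the maximum number of edges in a graph on $p$ vertices that contains no subgraph isomorphic to $L$. For $n\ge 6$, $T_n^3$ is the tree on vertex set $\{v_0,\ldots,v_{n-1}\}$ with edge set $\{v_0v_1,v_0v_2,\ldots,v_0v_{n-4},\ v_1v_{n-3},\ v_1v_{n-2},\ v_1v_{n-1}\}$. $\lfloor x\rfloor$ is the greatest integer not exceeding $x$; $\mathbb N=\{1,2,\ldots\}$. *)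

theory Defs
  imports Main
begin

definition simple_graph :: "'a set \<Rightarrow> 'a set set \<Rightarrow> bool" where
  "simple_graph V E \<longleftrightarrow> finite V \<and> (\<forall>e\<in>E. e \<subseteq> V \<and> card e = 2)"

definition contains_copy :: "'b set \<Rightarrow> 'b set set \<Rightarrow> 'a set \<Rightarrow> 'a set set \<Rightarrow> bool" where
  "contains_copy VL EL V E \<longleftrightarrow>
     (\<exists>f. inj_on f VL \<and> f ` VL \<subseteq> V \<and> (\<forall>e\<in>EL. f ` e \<in> E))"

definition ex :: "nat \<Rightarrow> 'b set \<Rightarrow> 'b set set \<Rightarrow> nat" where
  "ex p VL EL = Max {card E | E. simple_graph {0..<p} E \<and> \<not> contains_copy VL EL {0..<p::nat} E}"

text \<open>The tree T_n^3 on vertex set {0..<n} (vertex v_i is i).\<close>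

definition T3 :: "nat \<Rightarrow> nat set set" where
  "T3 n = {{0, i} | i. 1 \<le> i \<and> i \<le> n - 4} \<union> {{1, n - 3}, {1, n - 2}, {1, n - 1}}"

end

theory Submission
  imports Defs
begin

text \<open>
  The tree is a double star, so a graph contains it iff some edge \<open>uv\<close> with \<open>deg u \<ge> n - 4\<close> and
  \<open>deg v \<ge> 4\<close> satisfies \<open>|N(u) \<union> N(v)| \<ge> n\<close>. For the upper bound, measure a graph by its deficit
  \<open>\<Sum>(n - 2 - deg v)\<close>, which vanishes on disjoint copies of \<open>K\<^bsub>n-1\<^esub>\<close>, and bound it below by a function of
  the order modulo \<open>n - 1\<close>, by induction: a vertex of degree at most 3 can be deleted; a vertex of degree
  \<open>n - 2\<close> or \<open>n - 3\<close> has a closed neighbourhood with so few edges leaving it that it (possibly with one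
  more vertex) can be deleted. Otherwise all degrees lie in \<open>[4, n - 4]\<close>, the deficit is at least twice
  the order, and only the orders \<open>2n - 11, \<dots>, 2n - 8\<close> need a closer look at the closed
  neighbourhood of a vertex of degree \<open>n - 4\<close>. If \<open>n\<close> is odd then the deficit is odd, which gains 1.

  The bound is attained by \<open>k K\<^bsub>n-1\<^esub> \<union> K\<^bsub>n-8\<^esub>\<close> or by \<open>(k - 1) K\<^bsub>n-1\<^esub>\<close> together with a graph of order
  \<open>2n - 9\<close>: from cliques of orders \<open>n - 3\<close> and \<open>n - 6\<close>, remove a cubic bipartite graph inside the first
  and add a 2-regular bipartite graph between the two.
\<close>

subsection \<open>Neighbourhoods and the double star\<close>

text \<open>\<open>nbrs\<close> is cut down to \<open>V\<close>, so that deleting vertices means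
  shrinking \<open>V\<close> with \<open>E\<close> fixed: \<open>W\<close> and \<open>E\<close> then
  describe the induced subgraph.\<close>

definition nbrs :: "'a set \<Rightarrow> 'a set set \<Rightarrow> 'a \<Rightarrow> 'a set" where
  "nbrs V E v = {w \<in> V. {v, w} \<in> E}"

abbreviation deg :: "'a set \<Rightarrow> 'a set set \<Rightarrow> 'a \<Rightarrow> nat" where
  "deg V E v \<equiv> card (nbrs V E v)"

text \<open>The union below contains \<open>u\<close> and \<open>v\<close> themselves, so the threshold is \<open>n\<close>, not \<open>n - 2\<close>.\<close>

definition joint_bounded :: "nat \<Rightarrow> 'a set \<Rightarrow> 'a set set \<Rightarrow> bool" where
  "joint_bounded n V E \<longleftrightarrow>
     (\<forall>u\<in>V. \<forall>v\<in>nbrs V E u. n - 4 \<le> deg V E u \<longrightarrow> 4 \<le> deg V E v \<longrightarrow>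
        card (nbrs V E u \<union> nbrs V E v) < n)"

lemma finite_nbrs [simp]: "finite V \<Longrightarrow> finite (nbrs V E v)"
  by (simp add: nbrs_def)

lemma nbrs_sym: "u \<in> V \<Longrightarrow> v \<in> nbrs V E u \<Longrightarrow> u \<in> nbrs V E v"
  by (simp add: nbrs_def insert_commute)

lemma nbrs_subset: "nbrs V E v \<subseteq> V"
  by (auto simp: nbrs_def)

lemma nbrs_mono: "W \<subseteq> V \<Longrightarrow> nbrs W E v \<subseteq> nbrs V E v"
  by (auto simp: nbrs_def)

lemma not_self_nbr: "\<forall>e\<in>E. card e = 2 \<Longrightarrow> v \<notin> nbrs V E v"
  by (auto simp: nbrs_def)

lemma joint_bounded_mono:
  assumes "joint_bounded n V E" "W \<subseteq> V" "finite V"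
  shows "joint_bounded n W E"
  unfolding joint_bounded_def
proof (intro ballI impI)
  fix u v
  assume u: "u \<in> W" and v: "v \<in> nbrs W E u" and du: "n - 4 \<le> deg W E u" and dv: "4 \<le> deg W E v"
  have m: "deg W E x \<le> deg V E x" for x
    using assms by (intro card_mono nbrs_mono) auto
  have "card (nbrs V E u \<union> nbrs V E v) < n"
    using assms(1) u v du dv m[of u] m[of v] nbrs_mono[OF assms(2), of E u] assms(2)
    unfolding joint_bounded_def by (meson le_trans subsetD)
  moreover have "card (nbrs W E u \<union> nbrs W E v) \<le> card (nbrs V E u \<union> nbrs V E v)"
    using assms by (intro card_mono Un_mono nbrs_mono) auto
  ultimately show "card (nbrs W E u \<union> nbrs W E v) < n"
    by simp
qed

text \<open>For the further neighbours \<open>P\<close> of \<open>u\<close> and \<open>Q\<close> of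
  \<open>v\<close>, the lower bounds n - 5, 3 and n - 2 on the sizes of \<open>P\<close>,
  \<open>Q\<close> and their union are Hall's condition for disjoint leaf sets of sizes n - 5 and
  3.\<close>

lemma copy_if_not_joint_bounded:
  assumes "n \<ge> 6" "finite V" "\<forall>e\<in>E. card e = 2" "\<not> joint_bounded n V E"
  shows "contains_copy {0..<n} (T3 n) V E"
proof -
  obtain u v where uv: "u \<in> V" "v \<in> nbrs V E u" "n - 4 \<le> deg V E u" "4 \<le> deg V E v"
    "n \<le> card (nbrs V E u \<union> nbrs V E v)"
    using assms(4) unfolding joint_bounded_def by (auto simp: not_less)
  define P where "P = nbrs V E u - {v}"
  define Q where "Q = nbrs V E v - {u}"
  have fin: "finite P" "finite Q" using assms(2) by (auto simp: P_def Q_def)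
  have uv': "u \<in> nbrs V E v" "v \<in> V"
    using nbrs_sym[OF uv(1,2)] uv(2) by (auto simp: nbrs_def)
  have irr: "u \<notin> nbrs V E u" "v \<notin> nbrs V E v" using not_self_nbr[OF assms(3)] by auto
  have "u \<noteq> v" using uv irr by auto
  have cP: "card P \<ge> n - 5" using uv by (simp add: P_def)
  have cQ: "card Q \<ge> 3" using uv uv' by (simp add: Q_def)
  have "nbrs V E u \<union> nbrs V E v = insert u (insert v (P \<union> Q))"
    using uv uv' unfolding P_def Q_def by auto
  moreover have "u \<notin> P \<union> Q" "v \<notin> P \<union> Q" using irr by (auto simp: P_def Q_def)
  ultimately have cPQ: "card (P \<union> Q) \<ge> n - 2"
    using uv(5) fin \<open>u \<noteq> v\<close> by simp
  \<comment> \<open>The three leaves at \<open>v\<close> are taken outside \<open>P\<close> as far as possible.\<close>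
  obtain S where S: "S \<subseteq> Q" "card S = 3" "card (P - S) \<ge> n - 5"
  proof (cases "card (Q - P) \<ge> 3")
    case True
    then obtain S where "S \<subseteq> Q - P" "card S = 3" by (meson obtain_subset_with_card_n)
    moreover from this have "P - S = P" by auto
    ultimately show ?thesis using that[of S] cP by auto
  next
    case False
    have "card Q = card (Q - P) + card (Q \<inter> P)"
      using fin by (metis card_Diff_subset_Int card_mono finite_Int inf_le1 le_add_diff_inverse2)
    then have "3 - card (Q - P) \<le> card (Q \<inter> P)" using cQ by simp
    then obtain R where R: "R \<subseteq> Q \<inter> P" "card R = 3 - card (Q - P)"
      by (meson obtain_subset_with_card_n)
    have fR: "finite R" using R fin by (meson finite_Int finite_subset)
    have "card ((Q - P) \<union> R) = card (Q - P) + card R"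
      using fin fR R by (intro card_Un_disjoint) auto
    then have c3: "card ((Q - P) \<union> R) = 3" using R False by simp
    \<comment> \<open>The chosen set contains all of \<open>Q - P\<close>, so it covers the union
      together with what is left of \<open>P\<close>; the latter has at least (n - 2) - 3
      vertices.\<close>
    have "P \<union> Q = (P - ((Q - P) \<union> R)) \<union> ((Q - P) \<union> R)" using R by auto
    then have "card (P \<union> Q) \<le> card (P - ((Q - P) \<union> R)) + 3"
      using c3 by (metis card_Un_le)
    then show ?thesis using that[of "(Q - P) \<union> R"] R c3 cPQ by auto
  qed
  obtain R where R: "R \<subseteq> P - S" "card R = n - 5" using S(3) by (meson obtain_subset_with_card_n)
  have fS: "finite S" "finite R" using S R fin by (meson finite_subset finite_Diff)+
  obtain g where g: "bij_betw g {2..n-4} R"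
    using finite_same_card_bij[of "{2..n-4}" R] fS R assms(1) by auto
  obtain h where h: "bij_betw h {n-3..<n} S"
    using finite_same_card_bij[of "{n-3..<n}" S] fS S assms(1) by auto
  define f where "f i = (if i = 0 then u else if i = 1 then v else if i \<le> n - 4 then g i else h i)"
    for i
  have dom: "{0..<n} = {0} \<union> {1} \<union> {2..n-4} \<union> {n-3..<n}" using assms(1) by auto
  have b1: "bij_betw f {0} {u}" "bij_betw f {1} {v}" by (auto simp: f_def bij_betw_def)
  have b2: "bij_betw f {2..n-4} R" using g by (subst bij_betw_cong[of _ _ g]) (auto simp: f_def)
  have b3: "bij_betw f {n-3..<n} S"
    using h assms(1) by (subst bij_betw_cong[of _ _ h]) (auto simp: f_def)
  have sub: "R \<subseteq> P" "R \<inter> S = {}" "S \<subseteq> Q" using R S by auto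
  have "bij_betw f {0..<n} ({u} \<union> {v} \<union> R \<union> S)"
    unfolding dom using sub \<open>u \<noteq> v\<close> \<open>u \<notin> P \<union> Q\<close> \<open>v \<notin> P \<union> Q\<close>
    by (intro bij_betw_combine b1 b2 b3) auto
  moreover have "{u} \<union> {v} \<union> R \<union> S \<subseteq> V"
    using uv(1) uv'(2) sub(1,3) by (auto simp: P_def Q_def nbrs_def)
  moreover have "f ` e \<in> E" if "e \<in> T3 n" for e
  proof -
    have fR: "f i \<in> R" if "2 \<le> i" "i \<le> n - 4" for i using b2 that by (auto simp: bij_betw_def)
    have fS: "f i \<in> S" if "n - 3 \<le> i" "i < n" for i using b3 that by (auto simp: bij_betw_def)
    consider i where "e = {0, i}" "1 \<le> i" "i \<le> n - 4"
      | i where "e = {1, i}" "n - 3 \<le> i" "i < n"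
      using \<open>e \<in> T3 n\<close> assms(1) unfolding T3_def by auto
    then show ?thesis
    proof cases
      case 1
      have "f i \<in> nbrs V E u"
      proof (cases "i = 1")
        case True then show ?thesis using uv by (simp add: f_def)
      next
        case False then show ?thesis using fR[of i] 1 sub by (auto simp: P_def)
      qed
      then have "{f 0, f i} \<in> E" by (auto simp: f_def nbrs_def)
      then show ?thesis using 1 by simp
    next
      case 2
      then have "f i \<in> nbrs V E v" using fS[of i] sub by (auto simp: Q_def)
      then have "{f 1, f i} \<in> E" by (auto simp: f_def nbrs_def)
      then show ?thesis using 2 by simp
    qed
  qed
  ultimately show ?thesis
    unfolding contains_copy_def by (intro exI[of _ f]) (auto simp: bij_betw_def)
qed

text \<open>The images of the two centres have n - 4 and 4 neighbours inside the copy, and these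
  together cover all its n vertices.\<close>

lemma not_joint_bounded_if_copy:
  assumes "n \<ge> 6" "finite V" "contains_copy {0..<n} (T3 n) V E"
  shows "\<not> joint_bounded n V E"
proof -
  obtain f where f: "inj_on f {0..<n}" "f ` {0..<n} \<subseteq> V" "\<And>e. e \<in> T3 n \<Longrightarrow> f ` e \<in> E"
    using assms(3) unfolding contains_copy_def by auto
  have e0: "f i \<in> nbrs V E (f 0)" if "i \<in> {1..n-4}" for i
  proof -
    have "{0, i} \<in> T3 n" using that by (auto simp: T3_def)
    from f(3)[OF this] show ?thesis using f(2) that by (auto simp: nbrs_def)
  qed
  have e1: "f i \<in> nbrs V E (f 1)" if "i \<in> insert 0 {n-3..<n}" for i
  proof -
    have "i = 0 \<or> i = n - 3 \<or> i = n - 2 \<or> i = n - 1" using that by auto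
    then have "{1, i} \<in> T3 n" using assms(1) by (auto simp: T3_def insert_commute)
    from f(3)[OF this] show ?thesis using f(2) that assms(1) by (auto simp: nbrs_def)
  qed
  have inj: "card (f ` S) = card S" if "S \<subseteq> {0..<n}" for S
    using f(1) that by (meson card_image inj_on_subset)
  have "card (f ` {1..n-4}) \<le> deg V E (f 0)"
    using e0 assms(2) by (intro card_mono) auto
  moreover have "{1..n-4} \<subseteq> {0..<n}" using assms(1) by auto
  ultimately have d0: "n - 4 \<le> deg V E (f 0)" using inj[of "{1..n-4}"] by simp
  have "card (f ` insert 0 {n-3..<n}) \<le> deg V E (f 1)"
    using e1 assms(2) by (intro card_mono) auto
  then have d1: "4 \<le> deg V E (f 1)" using inj[of "insert 0 {n-3..<n}"] assms(1) by auto
  have "{0..<n} = {1..n-4} \<union> insert 0 {n-3..<n}" using assms(1) by auto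
  then have "f ` {0..<n} \<subseteq> nbrs V E (f 0) \<union> nbrs V E (f 1)" using e0 e1 by auto
  then have "card (f ` {0..<n}) \<le> card (nbrs V E (f 0) \<union> nbrs V E (f 1))"
    using assms(2) by (intro card_mono) auto
  then have "n \<le> card (nbrs V E (f 0) \<union> nbrs V E (f 1))" using inj[of "{0..<n}"] by simp
  moreover have "f 1 \<in> nbrs V E (f 0)" using e0[of 1] assms(1) by auto
  moreover have "f 0 \<in> V" using f(2) assms(1) by auto
  ultimately show ?thesis using d0 d1 unfolding joint_bounded_def by (meson not_less)
qed

lemma degree_sum:
  assumes "simple_graph V E"
  shows "(\<Sum>v\<in>V. deg V E v) = 2 * card E"
proof -
  have fV: "finite V" and E: "\<And>e. e \<in> E \<Longrightarrow> e \<subseteq> V \<and> card e = 2"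
    using assms by (auto simp: simple_graph_def)
  have fE: "finite E" using E fV by (meson Pow_iff finite_Pow_iff finite_subset subsetI)
  have "deg V E v = card {e \<in> E. v \<in> e}" if "v \<in> V" for v
  proof (rule bij_betw_same_card[of "\<lambda>w. {v, w}"])
    show "bij_betw (\<lambda>w. {v, w}) (nbrs V E v) {e \<in> E. v \<in> e}"
      unfolding bij_betw_def
    proof
      show "inj_on (\<lambda>w. {v, w}) (nbrs V E v)" by (auto simp: inj_on_def doubleton_eq_iff)
      have "e \<in> (\<lambda>w. {v, w}) ` nbrs V E v" if e: "e \<in> E" "v \<in> e" for e
      proof -
        obtain w where "e = {v, w}" using E[OF e(1)] e(2) by (auto simp: card_2_iff)
        then show ?thesis using E e by (auto simp: nbrs_def)
      qed
      then show "(\<lambda>w. {v, w}) ` nbrs V E v = {e \<in> E. v \<in> e}" by (auto simp: nbrs_def)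
    qed
  qed
  then have "(\<Sum>v\<in>V. deg V E v) = (\<Sum>v\<in>V. card {e \<in> E. v \<in> e})" by simp
  also have "\<dots> = (\<Sum>e\<in>E. card {v \<in> V. v \<in> e})"
    by (rule sum_multicount_gen) (use fV fE in auto)
  also have "\<dots> = (\<Sum>e\<in>E. 2)"
  proof (rule sum.cong)
    fix e assume "e \<in> E"
    then have "{v \<in> V. v \<in> e} = e" "card e = 2" using E by auto
    then show "card {v \<in> V. v \<in> e} = 2" by simp
  qed simp
  finally show ?thesis by simp
qed

subsection \<open>Deficits\<close>

definition deficit :: "nat \<Rightarrow> 'a set \<Rightarrow> 'a set set \<Rightarrow> int" where
  "deficit n V E = (\<Sum>v\<in>V. int n - 2 - int (deg V E v))"

lemma deg_split:
  assumes "finite V" "A \<subseteq> V"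
  shows "deg V E v = deg (V - A) E v + deg A E v"
proof -
  have "nbrs V E v = nbrs (V - A) E v \<union> nbrs A E v" using assms(2) by (auto simp: nbrs_def)
  moreover have "nbrs (V - A) E v \<inter> nbrs A E v = {}" by (auto simp: nbrs_def)
  ultimately show ?thesis using assms finite_subset[OF assms(2,1)] by (simp add: card_Un_disjoint)
qed

text \<open>Deleting \<open>A\<close> lowers the degree sum on the rest by the number of crossing
  edges; each is charged to its end in \<open>A\<close>, hence the second subtraction.\<close>

lemma deficit_remove:
  assumes "finite V" "A \<subseteq> V"
  shows "deficit n V E = deficit n (V - A) E
           + (\<Sum>a\<in>A. int n - 2 - int (deg V E a) - int (deg (V - A) E a))"
proof -
  let ?B = "V - A"
  have fA: "finite A" using assms finite_subset by blast
  have "(\<Sum>v\<in>?B. deg A E v) = (\<Sum>a\<in>A. deg ?B E a)"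
    unfolding nbrs_def
    by (rule sum_multicount_gen) (use assms(1) fA in \<open>auto simp: insert_commute\<close>)
  then have cross: "(\<Sum>v\<in>?B. int (deg A E v)) = (\<Sum>a\<in>A. int (deg ?B E a))"
    by (metis of_nat_sum)
  have "deficit n V E = (\<Sum>v\<in>?B. int n - 2 - int (deg V E v)) + (\<Sum>v\<in>A. int n - 2 - int (deg V E v))"
    unfolding deficit_def using assms by (rule sum.subset_diff[rotated])
  also have "(\<Sum>v\<in>?B. int n - 2 - int (deg V E v)) = deficit n ?B E - (\<Sum>v\<in>?B. int (deg A E v))"
    unfolding deficit_def deg_split[OF assms] by (simp add: sum_subtractf[symmetric] algebra_simps)
  finally show ?thesis
    unfolding cross by (simp add: sum_subtractf)
qed

lemma deficit_remove_vertex: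
  assumes "finite V" "w \<in> V" "\<forall>e\<in>E. card e = 2"
  shows "deficit n V E = deficit n (V - {w}) E + int n - 2 - 2 * int (deg V E w)"
proof -
  have "nbrs (V - {w}) E w = nbrs V E w" using not_self_nbr[OF assms(3), of w V] by (auto simp: nbrs_def)
  then show ?thesis using deficit_remove[of V "{w}" n E] assms by simp
qed

lemma deg_less_card:
  assumes "finite V" "v \<in> V" "\<forall>e\<in>E. card e = 2"
  shows "deg V E v < card V"
  using assms(2) not_self_nbr[OF assms(3), of v V] nbrs_subset[of V E v]
  by (intro psubset_card_mono assms(1)) auto

lemma deficit_ge_clique:
  assumes "finite V" "\<forall>e\<in>E. card e = 2"
  shows "int (card V) * (int n - 1 - int (card V)) \<le> deficit n V E"
proof -
  have "(\<Sum>v\<in>V. int n - 1 - int (card V)) \<le> deficit n V E"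
    unfolding deficit_def using deg_less_card[OF assms(1) _ assms(2)] by (intro sum_mono) force
  then show ?thesis by simp
qed

text \<open>The joint neighbourhood has fewer than n vertices, yet contains the closed neighbourhood
  of \<open>u\<close> and, disjoint from it, the outside neighbours of \<open>v\<close>.\<close>

lemma deg_outside_closed_nbhd:
  assumes "finite V" "\<forall>e\<in>E. card e = 2" "joint_bounded n V E"
    and "u \<in> V" "v \<in> nbrs V E u" "n \<le> deg V E u + 4" "4 \<le> deg V E v"
  shows "deg (V - insert u (nbrs V E u)) E v + deg V E u + 2 \<le> n"
proof -
  let ?A = "insert u (nbrs V E u)"
  have u: "u \<notin> nbrs V E u" "u \<in> nbrs V E v"
    using not_self_nbr[OF assms(2)] nbrs_sym[OF assms(4,5)] by auto
  have "card (nbrs (V - ?A) E v \<union> ?A) = deg (V - ?A) E v + card ?A"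
    using assms(1) by (intro card_Un_disjoint) (auto simp: nbrs_def)
  moreover have "nbrs (V - ?A) E v \<union> ?A \<subseteq> nbrs V E u \<union> nbrs V E v"
    using u by (auto simp: nbrs_def)
  then have "card (nbrs (V - ?A) E v \<union> ?A) \<le> card (nbrs V E u \<union> nbrs V E v)"
    using assms(1) by (intro card_mono) auto
  moreover have "card ?A = deg V E u + 1" using u assms(1) by simp
  moreover have "card (nbrs V E u \<union> nbrs V E v) < n"
    using assms unfolding joint_bounded_def by auto
  ultimately show ?thesis by simp
qed

lemma no_outside_nbr: "nbrs (V - insert u (nbrs V E u)) E u = {}"
  by (auto simp: nbrs_def)

section \<open>The periodic lower bound function\<close>

text \<open>The first term is the deficit of a clique of order n - 8, the second that of the
  two-block graph of order 2n - 9 for even n.\<close>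

definition tau :: "nat \<Rightarrow> int" where
  "tau n = min (7 * int n - 56) (6 * int n - 30)"

text \<open>
  Among all functions of the residue \<open>r\<close> with value \<open>tau n\<close> at \<open>r = n - 8\<close>, this is the smallest
  nonnegative one that grows by at most \<open>n - 8\<close> (deletion of a vertex of degree 3) and drops by at most
  \<open>n - 2\<close> (deletion of a \<open>K\<^bsub>n-2\<^esub>\<close>) per step.
\<close>

definition psi :: "nat \<Rightarrow> int \<Rightarrow> int" where
  "psi n r = max 0 (min (tau n - (int n - 8) * (int n - 8 - r)) (tau n - (int n - 2) * (r + 8 - int n)))"

definition bound :: "nat \<Rightarrow> nat \<Rightarrow> int" where
  "bound n p = psi n (int (p mod (n - 1)))"

text \<open>Both ends represent the same residue, so the step inequalities survive the wrap-around.
  The value at 0 uses 7 <= n - 8.\<close>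

lemma psi_zero:
  assumes "15 \<le> n"
  shows "psi n 0 = 0" "psi n (int n - 1) = 0"
proof -
  have "7 * (int n - 8) \<le> (int n - 8) * (int n - 8)" using assms by (intro mult_right_mono) auto
  then show "psi n 0 = 0" by (simp add: psi_def tau_def)
  show "psi n (int n - 1) = 0" using assms by (simp add: psi_def tau_def algebra_simps)
qed

lemma psi_Suc: "15 \<le> n \<Longrightarrow> psi n (r + 1) \<le> psi n r + (int n - 8)"
  by (auto simp: psi_def algebra_simps max_def min_def)

lemma psi_le_psi_Suc: "15 \<le> n \<Longrightarrow> psi n r \<le> psi n (r + 1) + (int n - 2)"
  by (auto simp: psi_def algebra_simps max_def min_def)

lemma psi_le_tau:
  assumes "15 \<le> n"
  shows "psi n r \<le> tau n"
proof -
  have "0 \<le> tau n" using assms by (simp add: tau_def)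
  moreover have "0 \<le> (int n - 8) * (int n - 8 - r) \<or> 0 \<le> (int n - 2) * (r + 8 - int n)"
    using assms by (cases "r \<le> int n - 8") auto
  ultimately show ?thesis unfolding psi_def by linarith
qed

lemma bound_Suc_cases:
  assumes "15 \<le> n"
  obtains r where "bound n p = psi n r" "bound n (Suc p) = psi n (r + 1)"
proof (cases "Suc (p mod (n - 1)) = n - 1")
  case True
  then have "int (p mod (n - 1)) + 1 = int n - 1" using assms by linarith
  moreover have "bound n (Suc p) = 0"
    unfolding bound_def using True psi_zero(1)[OF assms] by (simp add: mod_Suc)
  ultimately have "bound n (Suc p) = psi n (int (p mod (n - 1)) + 1)"
    using psi_zero(2)[OF assms] by metis
  then show ?thesis using that bound_def by metis
next
  case False
  then have "bound n (Suc p) = psi n (int (p mod (n - 1)) + 1)"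
    unfolding bound_def by (simp add: mod_Suc add.commute)
  then show ?thesis using that bound_def by metis
qed

lemma bound_Suc: "15 \<le> n \<Longrightarrow> bound n (Suc p) \<le> bound n p + (int n - 8)"
  by (metis bound_Suc_cases psi_Suc)

lemma bound_le_bound_Suc: "15 \<le> n \<Longrightarrow> bound n p \<le> bound n (Suc p) + (int n - 2)"
  by (metis bound_Suc_cases psi_le_psi_Suc)

lemma bound_le_tau: "15 \<le> n \<Longrightarrow> bound n p \<le> tau n"
  by (simp add: bound_def psi_le_tau)

lemma bound_period: "bound n (p + (n - 1)) = bound n p"
  by (simp add: bound_def)

text \<open>Base case of the induction: the right-hand side is the deficit of a clique of order
  \<open>p\<close>.\<close>

lemma bound_le_order:
  assumes "15 \<le> n" "p \<le> n - 1"
  shows "bound n p \<le> int p * (int n - 1 - int p)"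
proof -
  have pos: "0 \<le> int p * (int n - 1 - int p)" using assms by (intro mult_nonneg_nonneg) auto
  show ?thesis
  proof (cases "p = n - 1")
    case True
    then show ?thesis using pos assms psi_zero(1)[OF assms(1)] by (simp add: bound_def)
  next
    case False
    then have b: "bound n p = psi n (int p)" using assms by (simp add: bound_def)
    consider "int p + 15 \<le> int n" | "int n < int p + 15" "int p + 8 \<le> int n" | "int n < int p + 8"
      by linarith
    then show ?thesis
    proof cases
      case 1
      then have "7 * (int n - 8) \<le> (int n - 8 - int p) * (int n - 8)"
        using assms by (intro mult_right_mono) auto
      then show ?thesis using pos unfolding b psi_def tau_def by (simp add: mult.commute)
    next
      case 2
      define j where "j = int n - 8 - int p"
      have j: "0 \<le> j" "j < 7" "int p = int n - 8 - j" using 2 by (auto simp: j_def)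
      \<comment> \<open>This product is the clique deficit minus the rising branch of
        \<open>psi\<close> with 7n - 56 for \<open>tau n\<close>; the next case does the same on the
        falling branch.\<close>
      have "0 \<le> j * (2 * int n - 23 - j)" using j assms by (intro mult_nonneg_nonneg) auto
      then show ?thesis using pos unfolding b psi_def tau_def j(3) by (simp add: algebra_simps)
    next
      case 3
      define j where "j = int p + 8 - int n"
      have j: "0 \<le> j" "j \<le> 7" "int p = int n - 8 + j" using 3 False assms by (auto simp: j_def)
      have "0 \<le> j * (13 - j)" using j by (intro mult_nonneg_nonneg) auto
      then show ?thesis using pos unfolding b psi_def tau_def j(3) by (simp add: algebra_simps)
    qed
  qed
qed

lemma bound_block:
  assumes "15 \<le> n" "n - 1 \<le> p" "p < 2 * n - 2"
  shows "bound n p = psi n (int p + 1 - int n)"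
proof -
  define r where "r = p - (n - 1)"
  have r: "p = r + (n - 1)" "r < n - 1" "int r = int p + 1 - int n" using assms by (auto simp: r_def)
  have "bound n p = bound n r" unfolding r(1) by (rule bound_period)
  then show ?thesis using r(2) by (simp add: bound_def r(3)[symmetric])
qed

lemma psi_upper:
  "psi n r \<le> 0 \<or> psi n r \<le> 7 * int n - 56 - (int n - 8) * (int n - 8 - r)"
  "psi n r \<le> 0 \<or> psi n r \<le> 6 * int n - 30 - (int n - 8) * (int n - 8 - r)"
  "psi n r \<le> 0 \<or> psi n r \<le> 7 * int n - 56 - (int n - 2) * (r + 8 - int n)"
  "psi n r \<le> 0 \<or> psi n r \<le> 6 * int n - 30 - (int n - 2) * (r + 8 - int n)"
  unfolding psi_def tau_def by (auto simp: min_def max_def)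

text \<open>Trading the slope n - 8 for 7 makes the estimate linear in \<open>n\<close> and
  \<open>r\<close>.\<close>

lemma psi_upper_linear:
  assumes "15 \<le> n" "r \<le> int n - 8"
  shows "psi n r \<le> 0 \<or> psi n r \<le> 6 * int n - 30 - 7 * (int n - 8 - r)"
proof -
  have "7 * (int n - 8 - r) \<le> (int n - 8) * (int n - 8 - r)"
    using assms by (intro mult_right_mono) auto
  then show ?thesis using psi_upper(2)[of n r] by linarith
qed

text \<open>Meant for graphs with all degrees at most n - 5, where each vertex contributes at least
  3 to the deficit.\<close>

lemma bound_le_triple:
  assumes "15 \<le> n" "n - 1 \<le> p"
  shows "bound n p \<le> 3 * int p - 2"
proof (cases "p + 9 < 2 * n")
  case True
  then have "bound n p = psi n (int p + 1 - int n)" using assms by (intro bound_block) auto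
  moreover have "psi n (int p + 1 - int n) \<le> 0 \<or>
      psi n (int p + 1 - int n) \<le> 6 * int n - 30 - 7 * (int n - 8 - (int p + 1 - int n))"
    using True by (intro psi_upper_linear assms(1)) auto
  ultimately show ?thesis using True assms by (elim disjE) simp_all
next
  case False
  then show ?thesis using bound_le_tau[OF assms(1), of p] assms unfolding tau_def by linarith
qed

text \<open>If all degrees are at most n - 4, the deficit is at least twice the order; this isolates
  the four orders around the peak 2n - 9 where that may be too little.\<close>

lemma bound_le_double:
  assumes "15 \<le> n" "n \<le> p" "2 * int p < bound n p"
  shows "p \<in> {2 * n - 11, 2 * n - 10, 2 * n - 9, 2 * n - 8}"
proof -
  have "p < 2 * n - 2 \<or> 3 * n \<le> p + 15 \<or> (2 * n \<le> p + 2 \<and> p + 15 < 3 * n)" by linarith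
  moreover have False if "3 * n \<le> p + 15"
    using that assms(3) bound_le_tau[OF assms(1), of p] unfolding tau_def by linarith
  moreover have False if h: "2 * n \<le> p + 2" "p + 15 < 3 * n"
  proof -
    define r where "r = p - (n - 1) - (n - 1)"
    have r: "p = r + (n - 1) + (n - 1)" "r < n - 1" "int r = int p + 2 - 2 * int n"
      using h assms(1,2) unfolding r_def by linarith+
    have "bound n p = bound n r" unfolding r(1) bound_period ..
    then have "bound n p = psi n (int r)" using r(2) by (simp add: bound_def)
    moreover have "psi n (int r) \<le> 0 \<or> psi n (int r) \<le> 6 * int n - 30 - 7 * (int n - 8 - int r)"
      using h r by (intro psi_upper_linear assms(1)) linarith
    ultimately show False using assms r(3) h by (elim disjE) simp_all
  qed
  moreover have "p \<in> {2 * n - 11, 2 * n - 10, 2 * n - 9, 2 * n - 8}" if "p < 2 * n - 2"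
  proof (rule ccontr)
    assume a: "\<not> ?thesis"
    have b: "2 * int p < psi n (int p + 1 - int n)" using bound_block[OF assms(1) _ that] assms by simp
    have "p \<noteq> 2 * n - 11" "p \<noteq> 2 * n - 10" "p \<noteq> 2 * n - 9" "p \<noteq> 2 * n - 8" using a by auto
    then consider "p + 12 \<le> 2 * n" | "2 * n \<le> p + 7" using assms(1) by linarith
    then show False
    proof cases
      case 1
      \<comment> \<open>The distance below the peak order 2n - 9, whose residue is n - 8; the other
        case measures the distance above it.\<close>
      define j where "j = 2 * int n - 9 - int p"
      have j: "3 \<le> j" "int p = 2 * int n - 9 - j" using 1 by (auto simp: j_def)
      have "3 * (int n - 10) \<le> j * (int n - 10)" using j assms(1) by (intro mult_right_mono) auto
      then have "3 * int n - 30 + 2 * j \<le> j * (int n - 8)" by (simp add: algebra_simps)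
      moreover have "int n - 8 - (int p + 1 - int n) = j" using j by simp
      ultimately have "psi n (int p + 1 - int n) \<le> 0 \<or> psi n (int p + 1 - int n) \<le> 4 * int n - 26 - 2 * j"
        using psi_upper(1)[of n "int p + 1 - int n"] by (auto simp: mult.commute)
      then show False using b j(2) assms(1,2) by (elim disjE) simp_all
    next
      case 2
      define j where "j = int p + 1 - int n + 8 - int n"
      have j: "2 \<le> j" using 2 by (simp add: j_def)
      have "2 * (int n - 2) \<le> j * (int n - 2)" using j assms(1) by (intro mult_right_mono) auto
      then have "psi n (int p + 1 - int n) \<le> 0 \<or> psi n (int p + 1 - int n) \<le> 4 * int n - 26"
        using psi_upper(4)[of n "int p + 1 - int n"] unfolding j_def[symmetric]
        by (auto simp: mult.commute)
      then show False using b 2 assms(1,2) by (elim disjE) simp_all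
    qed
  qed
  ultimately show ?thesis by blast
qed

text \<open>The peak is at order 2n - 9, the other orders lie one or two steps down a slope. The
  value 6n - 42 is weakened to the deficit of a clique of order n - 7.\<close>

lemma bound_values:
  assumes "15 \<le> n"
  shows "bound n (2 * n - 8) \<le> 5 * int n - 28" "bound n (2 * n - 8) \<le> 6 * int n - 54"
    "bound n (2 * n - 9) \<le> 7 * int n - 56" "bound n (2 * n - 9) \<le> 6 * int n - 30"
    "bound n (2 * n - 10) \<le> 6 * int n - 42" "bound n (2 * n - 11) \<le> 5 * int n - 40"
proof -
  have r: "bound n (2 * n - 8) = psi n (int n - 7)" "bound n (2 * n - 10) = psi n (int n - 9)"
    "bound n (2 * n - 11) = psi n (int n - 10)"
    using assms bound_block[OF assms, of "2 * n - 8"] bound_block[OF assms, of "2 * n - 10"]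
      bound_block[OF assms, of "2 * n - 11"] by (simp_all add: of_nat_diff)
  show "bound n (2 * n - 8) \<le> 5 * int n - 28" "bound n (2 * n - 8) \<le> 6 * int n - 54"
    using psi_upper(3,4)[of n "int n - 7"] assms unfolding r by (auto simp: algebra_simps)
  show "bound n (2 * n - 9) \<le> 7 * int n - 56" "bound n (2 * n - 9) \<le> 6 * int n - 30"
    using bound_le_tau[OF assms, of "2 * n - 9"] by (auto simp: tau_def)
  show "bound n (2 * n - 10) \<le> 6 * int n - 42"
    using psi_upper(1)[of n "int n - 9"] assms unfolding r by (auto simp: algebra_simps)
  show "bound n (2 * n - 11) \<le> 5 * int n - 40"
    using psi_upper(1)[of n "int n - 10"] assms unfolding r by (auto simp: algebra_simps)
qed

subsection \<open>The upper bound\<close>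

text \<open>Delete \<open>w\<close> and compare the rest with a clique.\<close>

lemma deficit_ge_if_low_deg_vertex:
  assumes "finite V" "\<forall>e\<in>E. card e = 2" "w \<in> V" "deg V E w \<le> c"
  shows "(int (card V) - 1) * (int n - int (card V)) + int n - 2 - 2 * int c \<le> deficit n V E"
proof -
  have "card V = Suc (card (V - {w}))" using assms(1,3) by (metis card_Suc_Diff1)
  then have "int (card (V - {w})) = int (card V) - 1" by simp
  then show ?thesis
    using deficit_ge_clique[of "V - {w}" E n] deficit_remove_vertex[OF assms(1,3,2), of n] assms
    by (simp add: algebra_simps)
qed

text \<open>Each vertex contributes at least 2, or 3 if all degrees are at most n - 5. If neither
  suffices, the closed neighbourhood \<open>A\<close> of a vertex of degree n - 4 is split off and
  the rest \<open>B\<close> is compared with a clique.\<close>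

lemma deficit_ge_bound_if_degs_le:
  assumes n: "15 \<le> n" and fin: "finite V" and E: "\<forall>e\<in>E. card e = 2"
    and jb: "joint_bounded n V E"
    and lo: "\<And>v. v \<in> V \<Longrightarrow> 4 \<le> deg V E v" and hi: "\<And>v. v \<in> V \<Longrightarrow> deg V E v + 4 \<le> n"
    and large: "n \<le> card V"
  shows "bound n (card V) \<le> deficit n V E"
proof (cases "bound n (card V) \<le> 2 * int (card V) \<or> (\<forall>v\<in>V. deg V E v + 5 \<le> n)")
  case True
  have "(\<Sum>v\<in>V. 2) \<le> deficit n V E"
    unfolding deficit_def using hi by (intro sum_mono) force
  moreover have "(\<Sum>v\<in>V. 3) \<le> deficit n V E" if "\<forall>v\<in>V. deg V E v + 5 \<le> n"
    unfolding deficit_def using that by (intro sum_mono) force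
  moreover have "bound n (card V) \<le> 3 * int (card V) - 2"
    using n large by (intro bound_le_triple) auto
  ultimately show ?thesis using True by (auto simp: mult.commute)
next
  case False
  then obtain u where "u \<in> V" "\<not> deg V E u + 5 \<le> n" by auto
  with hi[of u] have u: "u \<in> V" "deg V E u + 4 = n" by auto
  have p: "card V \<in> {2 * n - 11, 2 * n - 10, 2 * n - 9, 2 * n - 8}"
    using False bound_le_double[OF n large] by auto
  define A where "A = insert u (nbrs V E u)"
  define B where "B = V - A"
  define t where "t a = int n - 2 - int (deg V E a) - int (deg B E a)" for a
  have AV: "A \<subseteq> V" using u nbrs_subset[of V E u] by (auto simp: A_def)
  have fA: "finite A" "finite B" using AV fin finite_subset by (auto simp: B_def)
  have cA: "card A + 3 = n" using u fin not_self_nbr[OF E, of u V] by (simp add: A_def)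
  have cB: "card B + card A = card V"
    using card_mono[OF fin AV] unfolding B_def using card_Diff_subset[OF fA(1) AV] by simp
  have out_u: "deg B E u = 0" unfolding B_def A_def no_outside_nbr by simp
  have out: "deg B E v \<le> 2" if "v \<in> A" for v
  proof (cases "v = u")
    case False
    then have v: "v \<in> nbrs V E u" "v \<in> V" using that AV by (auto simp: A_def)
    show ?thesis
      using deg_outside_closed_nbhd[OF fin E jb u(1) v(1)] lo[OF v(2)] u(2) by (simp add: A_def B_def)
  qed (use out_u in simp)
  have t_u: "t u = 2" using u out_u by (simp add: t_def)
  have t_nonneg: "0 \<le> t a" if "a \<in> A" for a
    using out[OF that] hi[of a] that AV by (auto simp: t_def)
  have dec: "deficit n V E = deficit n B E + sum t A"
    using deficit_remove[OF fin AV] by (simp add: B_def t_def)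
  have "t u \<le> sum t A" using t_nonneg fA by (intro member_le_sum) (auto simp: A_def)
  then have sum_t: "2 \<le> sum t A" using t_u by simp
  have dB: "int (card B) * (int n - 1 - int (card B)) \<le> deficit n B E"
    by (rule deficit_ge_clique[OF fA(2) E])
  have icB: "int (card B) = int (card V) - int n + 3" using cA cB by linarith
  \<comment> \<open>If \<open>isolated\<close> fails, \<open>B\<close> has a vertex of small degree inside \<open>B\<close> and is far from a clique.
    Otherwise every term \<open>t a\<close> is positive, and \<open>F\<close> collects the vertices with slack.\<close>
  define isolated where "isolated \<longleftrightarrow> (\<forall>v\<in>A. deg V E v + 4 = n \<longrightarrow> deg B E v = 0)"
  have few: "\<exists>w\<in>B. deg B E w \<le> 4" if h: "\<not> isolated"
  proof -
    obtain v where v: "v \<in> A" "deg V E v + 4 = n" "deg B E v \<noteq> 0"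
      using h by (auto simp: isolated_def)
    then obtain w where w: "w \<in> nbrs B E v" by fastforce
    then have wB: "w \<in> B" and wv: "w \<in> nbrs V E v" and vV: "v \<in> V"
      using AV v(1) by (auto simp: nbrs_def B_def)
    have "deg (V - insert v (nbrs V E v)) E w \<le> 2"
      using deg_outside_closed_nbhd[OF fin E jb vV wv] lo[of w] v(2) wB by (simp add: B_def)
    \<comment> \<open>A neighbour of \<open>w\<close> in \<open>B\<close> lies outside the closed
      neighbourhood of \<open>v\<close> or is a neighbour of \<open>v\<close> in \<open>B\<close>;
      there are at most two of each kind.\<close>
    moreover have "nbrs B E w \<subseteq> nbrs (V - insert v (nbrs V E v)) E w \<union> nbrs B E v"
      using v(1) by (auto simp: nbrs_def B_def)
    then have "deg B E w \<le> card (nbrs (V - insert v (nbrs V E v)) E w \<union> nbrs B E v)"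
      using fin fA by (intro card_mono) auto
    then have "deg B E w \<le> deg (V - insert v (nbrs V E v)) E w + deg B E v"
      using card_Un_le le_trans by blast
    ultimately show ?thesis using out[OF v(1)] wB by force
  qed
  define F where "F = {a \<in> A. t a \<noteq> 1}"
  have uF: "u \<in> F" using t_u by (simp add: F_def A_def)
  have fF: "finite F" using fA by (simp add: F_def)
  have t_full: "t a = 2" if "isolated" "a \<in> A" "deg V E a + 4 = n" for a
    using that by (auto simp: isolated_def t_def)
  have t_pos: "1 \<le> t a" if "isolated" "a \<in> A" for a
  proof (cases "deg V E a + 4 = n")
    case False
    then have "deg V E a + 5 \<le> n" using hi[of a] that AV by force
    then show ?thesis using out[OF that(2)] by (simp add: t_def)
  qed (use t_full[OF that] in simp)
  have tight: "int n - 3 + int (card F) \<le> sum t A" if "isolated"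
  proof -
    have "(\<Sum>a\<in>A. 1 + of_bool (a \<in> F)) \<le> sum t A"
      using t_pos[OF that] by (intro sum_mono) (force simp: F_def)
    moreover have "(\<Sum>a\<in>A. of_bool (a \<in> F) :: int) = int (card (A \<inter> F))"
      using fA by (simp add: of_bool_def sum.If_cases)
    moreover have "A \<inter> F = F" by (auto simp: F_def)
    ultimately show ?thesis using cA by (simp add: sum.distrib)
  qed
  have cF: "1 \<le> card F" using uF fF by (metis One_nat_def Suc_leI card_gt_0_iff empty_iff)
  consider "card V = 2 * n - 11" | "card V = 2 * n - 10" | "card V = 2 * n - 9" | "card V = 2 * n - 8"
    using p by auto
  then show ?thesis
  proof cases
    case 1
    then have b: "int (card B) = int n - 8" using icB n by simp
    have "7 * int n - 56 \<le> deficit n B E" using dB unfolding b by simp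
    then show ?thesis using dec sum_t bound_values(6)[OF n, folded 1] n by linarith
  next
    case 2
    then have b: "int (card B) = int n - 7" using icB n by simp
    have "6 * int n - 42 \<le> deficit n B E" using dB unfolding b by simp
    then show ?thesis using dec sum_t bound_values(5)[OF n, folded 2] n by linarith
  next
    case 4
    then have b: "int (card B) = int n - 5" using icB n by simp
    show ?thesis
    proof (cases isolated)
      case True
      have "4 * int n - 20 \<le> deficit n B E" using dB unfolding b by simp
      then show ?thesis using tight[OF True] cF dec bound_values(1)[OF n, folded 4] n by linarith
    next
      case False
      then obtain w where "w \<in> B" "deg B E w \<le> 4" using few by auto
      then have "6 * int n - 40 \<le> deficit n B E"
        using deficit_ge_if_low_deg_vertex[OF fA(2) E, of w 4 n] unfolding b by simp
      then show ?thesis using dec sum_t bound_values(2)[OF n, folded 4] n by linarith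
    qed
  next
    case 3
    then have b: "int (card B) = int n - 6" using icB n by simp
    note bv = bound_values(3,4)[OF n, folded 3]
    show ?thesis
    proof (cases isolated)
      case False
      then obtain w where "w \<in> B" "deg B E w \<le> 4" using few by auto
      then have "7 * int n - 52 \<le> deficit n B E"
        using deficit_ge_if_low_deg_vertex[OF fA(2) E, of w 4 n] unfolding b by simp
      then show ?thesis using dec sum_t bv n by linarith
    next
      case iso: True
      consider "3 \<le> card F" | w where "card F \<le> 2" "w \<in> B" "deg V E w + 4 = n"
        | "card F \<le> 2" "\<And>w. w \<in> B \<Longrightarrow> deg V E w + 4 \<noteq> n"
      proof -
        have "3 \<le> card F \<or> card F \<le> 2" by linarith
        then show ?thesis using that by blast
      qed
      then show ?thesis
      \<comment> \<open>Vertices of degree \<open>n - 4\<close> in \<open>A\<close> belong to \<open>F\<close>. One in \<open>B\<close> has a neighbour in \<open>A - F\<close>,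
        which has only two neighbours in \<open>B\<close> and forces it to have few neighbours in \<open>B\<close> as well.\<close>
      proof cases
        case 1
        \<comment> \<open>There is no slack: 5n - 30 for a clique of order n - 6, plus (n - 3) + 3
          from \<open>tight\<close>, is exactly the second term of \<open>tau n\<close>.\<close>
        have "5 * int n - 30 \<le> deficit n B E" using dB unfolding b by simp
        then show ?thesis using 1 tight[OF iso] dec bv n by linarith
      next
        case (2 w)
        have wV: "w \<in> V" "w \<notin> A" using 2 by (auto simp: B_def)
        have dw: "deg V E w = deg A E w + deg B E w"
          using deg_split[OF fin AV, of E w] by (simp add: B_def)
        have "deg B E w < card B" by (rule deg_less_card[OF fA(2) 2(2) E])
        \<comment> \<open>Inside \<open>B\<close> the degree of \<open>w\<close> is at most n - 7,
          so at least 3 of its n - 4 neighbours lie in \<open>A\<close>, more than \<open>F\<close>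
          can hold.\<close>
        then have "card F < deg A E w" using dw 2 b by linarith
        then obtain a where a: "a \<in> nbrs A E w" "a \<notin> F"
          using fF by (meson card_mono not_less subsetI)
        then have aA: "a \<in> A" and aV: "a \<in> V" and aw: "a \<in> nbrs V E w"
          using AV by (auto simp: nbrs_def)
        have ta: "t a = 1" using a(2) aA by (simp add: F_def)
        then have "deg V E a + 4 \<noteq> n" using t_full[OF iso aA] by auto
        then have da: "deg V E a + 5 = n" using hi[OF aV] out[OF aA] ta unfolding t_def by linarith
        have "deg (V - insert w (nbrs V E w)) E a \<le> 2"
          using deg_outside_closed_nbhd[OF fin E jb wV(1) aw] lo[OF aV] 2(3) by simp
        \<comment> \<open>The n - 5 neighbours of \<open>a\<close> are at most two outside the
          closed neighbourhood of \<open>w\<close>, at most two in \<open>B\<close>, and common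
          neighbours in \<open>A\<close>. So \<open>w\<close> has at least n - 9 neighbours in
          \<open>A\<close> and at most 5 in \<open>B\<close>.\<close>
        moreover have "nbrs V E a \<subseteq> nbrs (V - insert w (nbrs V E w)) E a \<union> nbrs B E a \<union> nbrs A E w"
          using 2(2) by (auto simp: nbrs_def B_def insert_commute)
        then have "deg V E a \<le> card (nbrs (V - insert w (nbrs V E w)) E a \<union> nbrs B E a \<union> nbrs A E w)"
          using fin fA by (intro card_mono) auto
        then have "deg V E a \<le> deg (V - insert w (nbrs V E w)) E a + deg B E a + deg A E w"
          using card_Un_le[of "nbrs (V - insert w (nbrs V E w)) E a \<union> nbrs B E a" "nbrs A E w"]
            card_Un_le[of "nbrs (V - insert w (nbrs V E w)) E a" "nbrs B E a"] by linarith
        ultimately have "deg B E w \<le> 5" using out[OF aA] da dw 2(3) by linarith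
        then have "7 * int n - 54 \<le> deficit n B E"
          using deficit_ge_if_low_deg_vertex[OF fA(2) E 2(2), of 5 n] unfolding b by simp
        then show ?thesis using dec tight[OF iso] cF bv n by linarith
      next
        case 3
        \<comment> \<open>All vertices of degree n - 4 lie in \<open>F\<close>, which has at most
          two elements; the total 3(2n - 9) - 2 = 6n - 29 suffices.\<close>
        have "3 - of_bool (v \<in> F) \<le> int n - 2 - int (deg V E v)" if "v \<in> V" for v
        proof (cases "deg V E v + 4 = n")
          case True
          then have "v \<in> A" using 3(2)[of v] that by (auto simp: B_def)
          then show ?thesis using True t_full[OF iso, of v] by (simp add: F_def)
        next
          case False
          then have "deg V E v + 5 \<le> n" using hi[OF that] by simp
          then show ?thesis by simp
        qed
        then have "(\<Sum>v\<in>V. 3 - of_bool (v \<in> F)) \<le> deficit n V E"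
          unfolding deficit_def by (rule sum_mono)
        moreover have "(\<Sum>v\<in>V. of_bool (v \<in> F) :: int) = int (card (V \<inter> F))"
          using fin by (simp add: of_bool_def sum.If_cases)
        moreover have "V \<inter> F = F" using AV by (auto simp: F_def)
        ultimately have "3 * int (card V) - 2 \<le> deficit n V E"
          using 3(1) by (simp add: sum_subtractf)
        then show ?thesis using bv(2) \<open>card V = 2 * n - 9\<close> n by simp
      qed
    qed
  qed
qed

text \<open>Each deletion matches a property of \<open>bound\<close>: a vertex of degree at most 3
  accounts for at least n - 8 (\<open>bound_Suc\<close>), n - 1 vertices need only nonnegative
  weight (\<open>bound_period\<close>), and n - 2 vertices need weight n - 2
  (\<open>bound_le_bound_Suc\<close>).\<close>

theorem deficit_ge_bound:
  assumes n: "15 \<le> n" and fin: "finite V" and E: "\<forall>e\<in>E. card e = 2"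
    and jb: "joint_bounded n V E"
  shows "bound n (card V) \<le> deficit n V E"
  using fin jb
proof (induction rule: finite_psubset_induct)
  case (psubset V)
  note fin = psubset.hyps(1) and jb = psubset.prems
  have IH: "bound n (card W) \<le> deficit n W E" if "W \<subset> V" for W
    using psubset.IH[OF that] joint_bounded_mono[OF jb _ fin] that by blast
  consider "card V \<le> n - 1" | v where "v \<in> V" "deg V E v \<le> 3"
    | "n \<le> card V" "\<And>v. v \<in> V \<Longrightarrow> 4 \<le> deg V E v"
  proof -
    have "n \<le> card V" if "\<not> card V \<le> n - 1" using that n by linarith
    moreover have "4 \<le> deg V E v" if "\<forall>v\<in>V. \<not> deg V E v \<le> 3" "v \<in> V" for v
      using that by force
    ultimately show ?thesis using that by blast
  qed
  then show ?case
  proof cases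
    case 1
    then show ?thesis
      using bound_le_order[OF n 1] deficit_ge_clique[OF fin E, of n] by linarith
  next
    case (2 v)
    have "card V = Suc (card (V - {v}))" using fin 2(1) by (metis card_Suc_Diff1)
    then have "bound n (card V) \<le> bound n (card (V - {v})) + (int n - 8)"
      using bound_Suc[OF n] by metis
    moreover have "bound n (card (V - {v})) \<le> deficit n (V - {v}) E" using 2(1) by (intro IH) auto
    ultimately show ?thesis using deficit_remove_vertex[OF fin 2(1) E, of n] 2(2) by linarith
  next
    case 3
    note large = 3(1) and lo = 3(2)
    have hi2: "deg V E v + 2 \<le> n" if v: "v \<in> V" for v
    proof (rule ccontr)
      assume "\<not> ?thesis"
      moreover obtain w where w: "w \<in> nbrs V E v" using lo[OF v] by fastforce
      moreover have "w \<in> V" using w by (simp add: nbrs_def)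
      ultimately show False
        using deg_outside_closed_nbhd[OF fin E jb v w] lo[of w] by linarith
    qed
    have out: "deg (V - insert u (nbrs V E u)) E v + deg V E u + 2 \<le> n"
      if "u \<in> V" "v \<in> insert u (nbrs V E u)" "n \<le> deg V E u + 4" for u v
    proof (cases "v = u")
      case True
      then show ?thesis using hi2[OF that(1)] by (simp add: no_outside_nbr)
    next
      case False
      then have v: "v \<in> nbrs V E u" "v \<in> V" using that by (auto simp: nbrs_def)
      show ?thesis using deg_outside_closed_nbhd[OF fin E jb that(1) v(1)] lo[OF v(2)] that(3) by linarith
    qed
    consider u where "u \<in> V" "deg V E u + 2 = n"
      | u where "u \<in> V" "deg V E u + 3 = n" "\<And>v. v \<in> V \<Longrightarrow> deg V E v + 3 \<le> n"
      | "\<And>v. v \<in> V \<Longrightarrow> deg V E v + 4 \<le> n"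
    proof -
      have "deg V E v + 3 \<le> n" if "\<forall>u\<in>V. deg V E u + 2 \<noteq> n" "v \<in> V" for v
        using hi2[of v] that by force
      moreover have "deg V E v + 4 \<le> n"
        if "\<forall>u\<in>V. deg V E u + 2 \<noteq> n" "\<forall>u\<in>V. deg V E u + 3 \<noteq> n" "v \<in> V" for v
        using hi2[of v] that by force
      ultimately show ?thesis using that by blast
    qed
    then show ?thesis
    proof cases
      case (1 u)
      define A where "A = insert u (nbrs V E u)"
      have A: "A \<subseteq> V" "A \<noteq> {}" using 1 nbrs_subset[of V E u] by (auto simp: A_def)
      have cA: "card A = n - 1" using 1 fin not_self_nbr[OF E, of u V] by (simp add: A_def)
      have cV: "card V = card (V - A) + (n - 1)"
        using card_mono[OF fin A(1)] card_Diff_subset[of A V] finite_subset[OF A(1) fin] A(1) cA by simp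
      \<comment> \<open>By \<open>out\<close> no edge leaves \<open>A\<close>, so it is dropped as a
        full block of order n - 1.\<close>
      have "0 \<le> (\<Sum>a\<in>A. int n - 2 - int (deg V E a) - int (deg (V - A) E a))"
      proof (rule sum_nonneg)
        fix a assume a: "a \<in> A"
        then show "0 \<le> int n - 2 - int (deg V E a) - int (deg (V - A) E a)"
          using out[of u a] hi2[of a] A(1) 1 by (force simp: A_def)
      qed
      moreover have "bound n (card (V - A)) \<le> deficit n (V - A) E" using A by (intro IH) auto
      moreover have "bound n (card V) = bound n (card (V - A))" unfolding cV by (rule bound_period)
      ultimately show ?thesis using deficit_remove[OF fin A(1), of n E] by linarith
    next
      case (2 u)
      define A where "A = insert u (nbrs V E u)"
      have A: "A \<subseteq> V" "A \<noteq> {}" using 2 nbrs_subset[of V E u] by (auto simp: A_def)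
      have cA: "card A + 2 = n" using 2 fin not_self_nbr[OF E, of u V] by (simp add: A_def)
      have cV: "card V = card (V - A) + card A"
        using card_mono[OF fin A(1)] card_Diff_subset[of A V] finite_subset[OF A(1) fin] A(1) by simp
      have outA: "deg (V - A) E a \<le> 1" if "a \<in> A" for a
        using out[of u a] that 2 by (simp add: A_def)
      have dec: "deficit n V E = deficit n (V - A) E
          + (\<Sum>a\<in>A. int n - 2 - int (deg V E a) - int (deg (V - A) E a))"
        by (rule deficit_remove[OF fin A(1)])
      show ?thesis
      proof (cases "\<exists>w\<in>V - A. deg (V - A) E w \<le> 2")
        \<comment> \<open>\<open>A\<close> has only n - 2 vertices; \<open>w\<close> completes it to
          n - 1, and a degree of at most 2 keeps the weight of \<open>w\<close> nonnegative.\<close>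
        case True
        then obtain w where w: "w \<in> V - A" "deg (V - A) E w \<le> 2" by auto
        have "Suc (card (V - A - {w})) = card (V - A)"
          using w fin by (intro card_Suc_Diff1) auto
        then have "card V = card (V - A - {w}) + (n - 1)" using cV cA by linarith
        then have "bound n (card V) = bound n (card (V - A - {w}))" by (simp only: bound_period)
        also have "\<dots> \<le> deficit n (V - A - {w}) E" using A w by (intro IH) auto
        also have "\<dots> \<le> deficit n (V - A) E"
          using deficit_remove_vertex[OF _ w(1) E, of n] fin w(2) n by simp
        also have "\<dots> \<le> deficit n V E"
        proof -
          have "0 \<le> int n - 2 - int (deg V E a) - int (deg (V - A) E a)" if "a \<in> A" for a
            using outA[OF that] 2(3)[of a] that A(1) by force
          then show ?thesis unfolding dec by (simp add: sum_nonneg)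
        qed
        finally show ?thesis .
      next
        case False
        \<comment> \<open>An outside neighbour \<open>w\<close> of \<open>a\<close> now has at least
          3 neighbours outside \<open>A\<close>, none adjacent to \<open>a\<close>. If
          \<open>a\<close> had degree n - 4 or more, only 2 would be allowed.\<close>
        have "1 \<le> int n - 2 - int (deg V E a) - int (deg (V - A) E a)" if a: "a \<in> A" for a
        proof (cases "deg (V - A) E a = 0")
          case True
          then show ?thesis using 2(3)[of a] a A(1) by force
        next
          case nz: False
          then have one: "deg (V - A) E a = 1" using outA[OF a] by simp
          then obtain w where w: "nbrs (V - A) E a = {w}" by (meson card_1_singletonE)
          then have wA: "w \<in> V - A" and wa: "w \<in> nbrs V E a" and aV: "a \<in> V"
            using a A(1) by (auto simp: nbrs_def)
          have "\<not> n \<le> deg V E a + 4"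
          proof
            assume f: "n \<le> deg V E a + 4"
            have "nbrs (V - A) E w \<subseteq> nbrs (V - insert a (nbrs V E a)) E w"
            proof
              fix x assume x: "x \<in> nbrs (V - A) E w"
              then have "x \<noteq> w" "x \<noteq> a" using not_self_nbr[OF E, of w "V - A"] a by (auto simp: nbrs_def)
              moreover from this have "x \<notin> nbrs V E a" using w x by (auto simp: nbrs_def)
              ultimately show "x \<in> nbrs (V - insert a (nbrs V E a)) E w" using x by (auto simp: nbrs_def)
            qed
            then have "deg (V - A) E w \<le> deg (V - insert a (nbrs V E a)) E w"
              using fin by (intro card_mono) auto
            then show False using False wA out[OF aV _ f, of w] wa f by force
          qed
          then show ?thesis using one by simp
        qed
        then have "(\<Sum>a\<in>A. 1) \<le> (\<Sum>a\<in>A. int n - 2 - int (deg V E a) - int (deg (V - A) E a))"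
          by (rule sum_mono)
        then have "int n - 2 \<le> (\<Sum>a\<in>A. int n - 2 - int (deg V E a) - int (deg (V - A) E a))"
          using cA by simp
        moreover have "bound n (card (V - A)) \<le> deficit n (V - A) E" using A by (intro IH) auto
        \<comment> \<open>\<open>A\<close> is one vertex short of a full block, so the comparison
          passes through the order one larger; the weight n - 2 of \<open>A\<close> pays for that
          step.\<close>
        moreover have "Suc (card V) = card (V - A) + (n - 1)" using cV cA by linarith
        then have "bound n (Suc (card V)) = bound n (card (V - A))" by (simp only: bound_period)
        ultimately show ?thesis using dec bound_le_bound_Suc[OF n, of "card V"] by linarith
      qed
    next
      case 3
      then show ?thesis using deficit_ge_bound_if_degs_le[OF n fin E jb lo _ large] by blast
    qed
  qed
qed

subsection \<open>The lower bound\<close>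

definition pairs :: "'a set \<Rightarrow> 'a set set" where
  "pairs S = {e. e \<subseteq> S \<and> card e = 2}"

lemma doubleton_in_pairs: "{u, w} \<in> pairs S \<longleftrightarrow> u \<in> S \<and> w \<in> S \<and> u \<noteq> w"
  by (auto simp: pairs_def card_insert_if)

lemma finite_pairs: "finite S \<Longrightarrow> finite (pairs S)"
  unfolding pairs_def by (rule finite_subset[of _ "Pow S"]) auto

lemma card_pairs: "finite S \<Longrightarrow> 2 * int (card (pairs S)) = int (card S) * (int (card S) - 1)"
proof -
  assume "finite S"
  then have "card (pairs S) = card S * (card S - 1) div 2"
    unfolding pairs_def by (simp add: n_subsets choose_two)
  moreover have "even (card S * (card S - 1))" by (cases "card S") simp_all
  ultimately have "2 * card (pairs S) = card S * (card S - 1)" by simp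
  then have "2 * int (card (pairs S)) = int (card S * (card S - 1))" by linarith
  then show ?thesis by (cases "card S") (simp_all add: algebra_simps)
qed

lemma finite_edges: "simple_graph V E \<Longrightarrow> finite E"
  unfolding simple_graph_def by (meson PowI finite_Pow_iff finite_subset subsetI)

text \<open>No edge joins the two sides: neighbourhoods in \<open>V\<close> are unchanged, and those
  of vertices of \<open>W\<close> stay inside \<open>W\<close>, which has fewer than n
  vertices.\<close>

lemma disjoint_clique:
  assumes "simple_graph V E" "joint_bounded n V E" "finite W" "V \<inter> W = {}" "card W < n"
  shows "simple_graph (V \<union> W) (E \<union> pairs W)"
    and "joint_bounded n (V \<union> W) (E \<union> pairs W)"
    and "card (E \<union> pairs W) = card E + card (pairs W)"
proof -
  have E: "e \<subseteq> V" "card e = 2" if "e \<in> E" for e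
    using assms(1) that by (auto simp: simple_graph_def)
  show "simple_graph (V \<union> W) (E \<union> pairs W)"
    using assms(1,3) by (auto simp: simple_graph_def pairs_def)
  have "e \<notin> pairs W" if "e \<in> E" for e
  proof
    assume "e \<in> pairs W"
    then have "e = {}" using E(1)[OF that] assms(4) by (auto simp: pairs_def)
    then show False using E(2)[OF that] by simp
  qed
  then have "E \<inter> pairs W = {}" by auto
  then show "card (E \<union> pairs W) = card E + card (pairs W)"
    by (intro card_Un_disjoint finite_edges[OF assms(1)] finite_pairs[OF assms(3)])
  have nV: "nbrs (V \<union> W) (E \<union> pairs W) v = nbrs V E v" if "v \<in> V" for v
  proof -
    have "v \<notin> W" using that assms(4) by auto
    moreover have "w \<in> V" if "{v, w} \<in> E" for w using E(1)[OF that] by auto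
    ultimately show ?thesis by (auto simp: nbrs_def doubleton_in_pairs)
  qed
  have nW: "nbrs (V \<union> W) (E \<union> pairs W) v \<subseteq> W" if "v \<in> W" for v
  proof -
    have "v \<notin> V" using that assms(4) by auto
    then have "{v, w} \<notin> E" for w using E(1)[of "{v, w}"] by auto
    then show ?thesis by (auto simp: nbrs_def doubleton_in_pairs)
  qed
  show "joint_bounded n (V \<union> W) (E \<union> pairs W)"
    unfolding joint_bounded_def
  proof (intro ballI impI)
    fix u v
    assume u: "u \<in> V \<union> W" and v: "v \<in> nbrs (V \<union> W) (E \<union> pairs W) u"
      and d: "n - 4 \<le> deg (V \<union> W) (E \<union> pairs W) u" "4 \<le> deg (V \<union> W) (E \<union> pairs W) v"
    show "card (nbrs (V \<union> W) (E \<union> pairs W) u \<union> nbrs (V \<union> W) (E \<union> pairs W) v) < n"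
    proof (cases "u \<in> V")
      case True
      then have "v \<in> nbrs V E u" "v \<in> V" using v nV[OF True] by (auto simp: nbrs_def)
      then show ?thesis using assms(2) d True nV unfolding joint_bounded_def by metis
    next
      case False
      then have uW: "u \<in> W" using u by auto
      then have "v \<in> W" using v nW by auto
      then have "card (nbrs (V \<union> W) (E \<union> pairs W) u \<union> nbrs (V \<union> W) (E \<union> pairs W) v) \<le> card W"
        using nW uW by (intro card_mono assms(3)) auto
      then show ?thesis using assms(5) by simp
    qed
  qed
qed

text \<open>Each new clique takes the next n - 1 numbers, so the vertex set stays an initial
  segment, as \<open>ex\<close> requires.\<close>

lemma add_cliques:
  assumes "simple_graph {0..<p} E" "joint_bounded n {0..<p} E" "1 \<le> n"
  obtains E' where "simple_graph {0..<p + k * (n - 1)} E'" "joint_bounded n {0..<p + k * (n - 1)} E'"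
    "2 * int (card E') = 2 * int (card E) + int k * (int n - 1) * (int n - 2)"
proof (induction k arbitrary: thesis)
  case 0
  then show ?case using assms by simp
next
  case (Suc k)
  obtain F where F: "simple_graph {0..<p + k * (n - 1)} F" "joint_bounded n {0..<p + k * (n - 1)} F"
    "2 * int (card F) = 2 * int (card E) + int k * (int n - 1) * (int n - 2)"
    using Suc.IH .
  define W where "W = {p + k * (n - 1)..<p + Suc k * (n - 1)}"
  have W: "finite W" "{0..<p + k * (n - 1)} \<inter> W = {}" "card W < n" "int (card W) = int n - 1"
    "{0..<p + k * (n - 1)} \<union> W = {0..<p + Suc k * (n - 1)}"
    using assms(3) by (auto simp: W_def)
  note F' = disjoint_clique[OF F(1,2) W(1,2,3), unfolded W(5)]
  have "2 * int (card (F \<union> pairs W)) = 2 * int (card E) + int (Suc k) * (int n - 1) * (int n - 2)"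
    using F(3) card_pairs[OF W(1)] unfolding F'(3) W(4) by (simp add: algebra_simps)
  then show ?case using Suc.prems[OF F'(1,2)] by blast
qed

section \<open>The two-block graph of order 2n - 9\<close>

text \<open>
  The vertices \<open>0, \<dots>, 2t - 1\<close> of the first clique lose the three edges in \<open>circ_edges\<close> and gain two in
  \<open>link_edges\<close>, so they end up with degree \<open>n - 5\<close>, whereas \<open>2t, \<dots>, n - 4\<close> keep degree \<open>n - 4\<close> and have no
  neighbour in the second clique.
\<close>

definition circ_edges :: "nat \<Rightarrow> nat set set" where
  "circ_edges t = (\<lambda>(i, j). {i, t + (i + j) mod t}) ` ({0..<t} \<times> {0..<3})"

text \<open>Vertex \<open>a\<close> gets one neighbour in each of two consecutive runs of length
  \<open>t\<close>, chosen by its residue modulo \<open>t\<close>; conversely, a linked vertex has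
  two partners below 2t that differ by \<open>t\<close>.\<close>

definition link_edges :: "nat \<Rightarrow> nat \<Rightarrow> nat set set" where
  "link_edges n t = (\<lambda>(a, s). {a, n - 3 + s * t + a mod t}) ` ({0..<2 * t} \<times> {0..<2})"

definition two_block :: "nat \<Rightarrow> nat \<Rightarrow> nat set set" where
  "two_block n t = (pairs {0..<n - 3} - circ_edges t) \<union> pairs {n - 3..<2 * n - 9} \<union> link_edges n t"

text \<open>The end below \<open>t\<close> identifies \<open>i\<close>, and t >= 3 keeps the three
  shifts distinct modulo \<open>t\<close>.\<close>

lemma card_circ_edges:
  assumes "3 \<le> t"
  shows "card (circ_edges t) = 3 * t"
proof -
  have "inj_on (\<lambda>(i, j). {i, t + (i + j) mod t}) ({0..<t} \<times> {0..<3})"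
  proof (rule inj_onI, clarify)
    fix i j i' j' :: nat
    assume h: "i \<in> {0..<t}" "i' \<in> {0..<t}" "j \<in> {0..<3}" "j' \<in> {0..<3}"
      "{i, t + (i + j) mod t} = {i', t + (i' + j') mod t}"
    then have i: "i = i'" "(i + j) mod t = (i' + j') mod t" by (auto simp: doubleton_eq_iff)
    then show "i = i' \<and> j = j'" using h assms by (auto simp: mod_if split: if_splits)
  qed
  then show ?thesis by (simp add: circ_edges_def card_image)
qed

lemma circ_nonnbrs:
  assumes "3 \<le> t" "u < 2 * t"
  obtains D where "card D = 3" "D \<subseteq> {0..<2 * t} - {u}" "\<And>d. d \<in> D \<Longrightarrow> {u, d} \<in> circ_edges t"
proof (cases "u < t")
  case True
  define D where "D = (\<lambda>j. t + (u + j) mod t) ` {0..<3}"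
  have "inj_on (\<lambda>j. t + (u + j) mod t) {0..<3}"
    using True assms(1) by (auto simp: inj_on_def mod_if split: if_splits)
  then have "card D = 3" by (simp add: D_def card_image)
  moreover have "D \<subseteq> {0..<2 * t} - {u}" using True assms(1) by (auto simp: D_def mod_if)
  moreover have "{u, d} \<in> circ_edges t" if "d \<in> D" for d
    using that True by (auto simp: D_def circ_edges_def image_iff)
  ultimately show ?thesis using that by blast
next
  case False
  define v where "v = u - t"
  have v: "u = t + v" "v < t" using False assms(2) by (auto simp: v_def)
  \<comment> \<open>The partners of \<open>t + v\<close> are v, v - 1 and v - 2 modulo t; adding t
    first avoids truncated subtraction.\<close>
  define D where "D = (\<lambda>j. (v + t - j) mod t) ` {0..<3}"
  have "inj_on (\<lambda>j. (v + t - j) mod t) {0..<3}"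
    using v assms(1) by (auto simp: inj_on_def mod_if split: if_splits)
  then have "card D = 3" by (simp add: D_def card_image)
  moreover have "D \<subseteq> {0..<2 * t} - {u}" using v assms(1) by (auto simp: D_def mod_if)
  moreover have "{u, d} \<in> circ_edges t" if dD: "d \<in> D" for d
  proof -
    obtain j where j: "j < 3" "d = (v + t - j) mod t" using dD by (auto simp: D_def)
    have d: "d < t" "v = (d + j) mod t" using j v assms(1) by (auto simp: mod_if)
    have "(\<lambda>(i, j). {i, t + (i + j) mod t}) (d, j) \<in> circ_edges t"
      unfolding circ_edges_def using d(1) j(1) by (intro imageI) simp
    then show ?thesis unfolding v(1) d(2) by (simp add: insert_commute)
  qed
  ultimately show ?thesis using that by blast
qed

lemma card_link_edges:
  assumes "3 + 2 * t \<le> n"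
  shows "card (link_edges n t) = 4 * t"
proof -
  have "inj_on (\<lambda>(a, s). {a, n - 3 + s * t + a mod t}) ({0..<2 * t} \<times> {0..<2})"
  proof (rule inj_onI, clarify)
    fix a s a' s' :: nat
    assume h: "a \<in> {0..<2 * t}" "a' \<in> {0..<2 * t}" "s \<in> {0..<2}" "s' \<in> {0..<2}"
      "{a, n - 3 + s * t + a mod t} = {a', n - 3 + s' * t + a' mod t}"
    have "a \<noteq> n - 3 + s' * t + a' mod t" using h(1) assms by simp
    then have eq: "a = a'" "n - 3 + s * t + a mod t = n - 3 + s' * t + a' mod t"
      using h(5) by (auto simp: doubleton_eq_iff)
    then have "s * t = s' * t" by simp
    moreover have "t \<noteq> 0" using h(1) by auto
    ultimately show "a = a' \<and> s = s'" using eq(1) by simp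
  qed
  then show ?thesis by (simp add: link_edges_def card_image)
qed

text \<open>The choice of \<open>t\<close> is the largest for which 2t vertices fit into the second
  clique. Linked vertices of the first clique have degree at most (n - 7) + 2 and those of the
  second at most (n - 7) + 2, so only unlinked vertices of the first can reach n - 4.\<close>

lemma two_block_bounds:
  assumes "15 \<le> n" "t = (n - 6) div 2"
  shows "simple_graph {0..<2 * n - 9} (two_block n t)"
    and "joint_bounded n {0..<2 * n - 9} (two_block n t)"
    and "2 * int (card (two_block n t)) = 2 * int n * int n - 20 * int n + 48 + 2 * int (n div 2)"
proof -
  let ?V = "{0..<2 * n - 9}" and ?E = "two_block n t"
  define A where "A = {0..<n - 3}"
  define B where "B = {n - 3..<2 * n - 9}"
  have t: "3 \<le> t" "2 * t + 6 \<le> n" "int t = int (n div 2) - 3" using assms by auto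
  have V: "?V = A \<union> B" "A \<inter> B = {}" "card A = n - 3" "card B = n - 6" "finite A" "finite B"
    using assms(1) by (auto simp: A_def B_def)
  have EE: "?E = (pairs A - circ_edges t) \<union> pairs B \<union> link_edges n t"
    by (simp add: two_block_def A_def B_def)
  have circ: "circ_edges t \<subseteq> pairs A"
  proof
    fix e assume "e \<in> circ_edges t"
    then obtain i j where ij: "i < t" "e = {i, t + (i + j) mod t}" by (auto simp: circ_edges_def)
    have "(i + j) mod t < t" using t by simp
    then have "t + (i + j) mod t < n - 3" using t by linarith
    then show "e \<in> pairs A" using ij t(1,2) by (auto simp: doubleton_in_pairs A_def)
  qed
  have link: "\<exists>a s. a < 2 * t \<and> s < 2 \<and> e = {a, n - 3 + s * t + a mod t} \<and> a \<in> A \<and> n - 3 + s * t + a mod t \<in> B"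
    if e: "e \<in> link_edges n t" for e
  proof -
    obtain a s where as: "a < 2 * t" "s < 2" "e = {a, n - 3 + s * t + a mod t}"
      using e by (auto simp: link_edges_def)
    have "a mod t < t" using t by simp
    moreover have "s * t \<le> t" using as(2) by (auto simp: less_2_cases_iff)
    ultimately have "n - 3 + s * t + a mod t < 2 * n - 9" using t(2) by linarith
    then have "a \<in> A \<and> n - 3 + s * t + a mod t \<in> B" using as(1) t(2) by (auto simp: A_def B_def)
    then show ?thesis using as by blast
  qed
  have not_in_link: "e \<notin> link_edges n t" if "e \<in> pairs A \<or> e \<in> pairs B" for e
    using link[of e] that V(2) by (auto simp: pairs_def)
  show sg: "simple_graph ?V ?E"
    unfolding simple_graph_def V(1)
  proof (intro conjI ballI)
    fix e assume "e \<in> ?E"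
    then consider "e \<in> pairs A" | "e \<in> pairs B" | "e \<in> link_edges n t" by (auto simp: EE)
    then have "e \<subseteq> A \<union> B \<and> card e = 2"
    proof cases
      case 3
      then obtain a b where ab: "e = {a, b}" "a \<in> A" "b \<in> B" using link by meson
      then have "a \<noteq> b" using V(2) by auto
      then show ?thesis using ab by auto
    qed (auto simp: pairs_def)
    then show "e \<subseteq> A \<union> B" "card e = 2" by auto
  qed (use V in auto)
  have "e \<notin> pairs B" if "e \<in> pairs A" for e
  proof
    assume "e \<in> pairs B"
    then have "e = {}" using that V(2) by (auto simp: pairs_def)
    then show False using that by (simp add: pairs_def)
  qed
  then have "pairs A \<inter> pairs B = {}" by blast
  then have "card ?E = card (pairs A - circ_edges t) + card (pairs B) + card (link_edges n t)"
    unfolding EE using not_in_link finite_pairs[OF V(5)] finite_pairs[OF V(6)]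
    by (subst card_Un_disjoint; (subst card_Un_disjoint)?) (auto simp: link_edges_def)
  moreover have "int (card (pairs A - circ_edges t)) = int (card (pairs A)) - 3 * int t"
    using card_circ_edges[OF t(1)] circ finite_pairs[OF V(5)] card_mono[OF finite_pairs[OF V(5)] circ]
    by (simp add: card_Diff_subset finite_subset of_nat_diff)
  ultimately have "2 * int (card ?E) = 2 * int (card (pairs A)) - 6 * int t + 2 * int (card (pairs B)) + 8 * int t"
    using card_link_edges[of t n] t by simp
  \<comment> \<open>Removing 3t edges and adding 4t leaves a net gain of t.\<close>
  also have "\<dots> = (int n - 3) * (int n - 4) + (int n - 6) * (int n - 7) + 2 * int t"
    unfolding card_pairs[OF V(5)] card_pairs[OF V(6)] V(3,4) using assms(1) by (simp add: of_nat_diff)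
  finally show "2 * int (card ?E) = 2 * int n * int n - 20 * int n + 48 + 2 * int (n div 2)"
    using t(3) by (simp add: algebra_simps)
  have nA: "w \<in> (A - {u}) - {d. {u, d} \<in> circ_edges t} \<or>
      u < 2 * t \<and> w \<in> (\<lambda>s. n - 3 + s * t + u mod t) ` {0..<2}"
    if "u \<in> A" "w \<in> nbrs ?V ?E u" for u w
  proof -
    have "u \<notin> B" "{u, w} \<in> ?E" using that V by (auto simp: nbrs_def)
    then consider "{u, w} \<in> pairs A - circ_edges t" | "{u, w} \<in> link_edges n t"
      by (auto simp: EE doubleton_in_pairs)
    then show ?thesis
    proof cases
      case 2
      then obtain a s where "a < 2 * t" "s < 2" "{u, w} = {a, n - 3 + s * t + a mod t}"
        "n - 3 + s * t + a mod t \<in> B" using link by meson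
      then show ?thesis using \<open>u \<notin> B\<close> by (auto simp: doubleton_eq_iff)
    qed (auto simp: doubleton_in_pairs)
  qed
  \<comment> \<open>A vertex of the second clique determines the residue of its partners modulo t,
    which leaves two candidates below 2t.\<close>
  have nB: "w \<in> B - {u} \<or> w \<in> {(u - (n - 3)) mod t, t + (u - (n - 3)) mod t}"
    if "u \<in> B" "w \<in> nbrs ?V ?E u" for u w
  proof -
    have "u \<notin> A" "{u, w} \<in> ?E" using that V by (auto simp: nbrs_def)
    then consider "{u, w} \<in> pairs B" | "{u, w} \<in> link_edges n t"
      by (auto simp: EE doubleton_in_pairs)
    then show ?thesis
    proof cases
      case 2
      then obtain a s where as: "a < 2 * t" "{u, w} = {a, n - 3 + s * t + a mod t}" "a \<in> A"
        using link by meson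
      then have "u = n - 3 + s * t + a mod t" "w = a" using \<open>u \<notin> A\<close> by (auto simp: doubleton_eq_iff)
      then have "(u - (n - 3)) mod t = w mod t" by (simp add: add.assoc)
      then show ?thesis using as(1) \<open>w = a\<close> by (auto simp: mod_if split: if_splits)
    qed (auto simp: doubleton_in_pairs)
  qed
  have full: "u \<in> A \<and> 2 * t \<le> u" if u: "u \<in> ?V" and d: "n - 4 \<le> deg ?V ?E u" for u
  proof (rule ccontr)
    assume neg: "\<not> ?thesis"
    have c2: "card ((\<lambda>s. n - 3 + s * t + u mod t) ` {0..<2}) \<le> 2"
      by (rule card_image_le[THEN le_trans]) auto
    show False
    proof (cases "u \<in> A")
      case True
      then have "u < 2 * t" using neg by simp
      then obtain D where D: "card D = 3" "D \<subseteq> {0..<2 * t} - {u}" "\<And>d. d \<in> D \<Longrightarrow> {u, d} \<in> circ_edges t"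
        using circ_nonnbrs t(1) by blast
      have fD: "finite D" using D(1) by (simp add: card_ge_0_finite)
      have DA: "D \<subseteq> A - {u}" using D(2) t(2) by (auto simp: A_def)
      have "card (A - {u} - D) = n - 7"
        using card_Diff_subset[OF fD DA] D(1) True V(3,5) assms(1) by simp
      moreover have "nbrs ?V ?E u \<subseteq> (A - {u} - D) \<union> (\<lambda>s. n - 3 + s * t + u mod t) ` {0..<2}"
        using nA[OF True] D(3) by blast
      then have "deg ?V ?E u \<le> card ((A - {u} - D) \<union> (\<lambda>s. n - 3 + s * t + u mod t) ` {0..<2})"
        using V(5) by (intro card_mono) auto
      then have "deg ?V ?E u \<le> card (A - {u} - D) + card ((\<lambda>s. n - 3 + s * t + u mod t) ` {0..<2})"
        using card_Un_le le_trans by blast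
      ultimately show False using c2 d assms(1) by linarith
    next
      case False
      then have uB: "u \<in> B" using u V(1) by auto
      have "nbrs ?V ?E u \<subseteq> (B - {u}) \<union> {(u - (n - 3)) mod t, t + (u - (n - 3)) mod t}"
        using nB[OF uB] by blast
      then have "deg ?V ?E u \<le> card ((B - {u}) \<union> {(u - (n - 3)) mod t, t + (u - (n - 3)) mod t})"
        using V(6) by (intro card_mono) auto
      then have "deg ?V ?E u \<le> card (B - {u}) + card {(u - (n - 3)) mod t, t + (u - (n - 3)) mod t}"
        using card_Un_le le_trans by blast
      moreover have "card {(u - (n - 3)) mod t, t + (u - (n - 3)) mod t} \<le> 2"
        by (simp add: card_insert_if)
      ultimately show False using uB V(4,6) d assms(1) by simp
    qed
  qed
  show "joint_bounded n ?V ?E"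
    unfolding joint_bounded_def
  proof (intro ballI impI)
    fix u v
    assume u: "u \<in> ?V" and v: "v \<in> nbrs ?V ?E u" and d: "n - 4 \<le> deg ?V ?E u"
    let ?S = "(\<lambda>s. n - 3 + s * t + v mod t) ` {0..<2}"
    have c2: "card ?S \<le> 2" by (rule card_image_le[THEN le_trans]) auto
    have uA: "u \<in> A" "2 * t \<le> u" using full[OF u d] by auto
    have NA: "nbrs ?V ?E u \<subseteq> A" using nA[OF uA(1)] uA(2) by force
    \<comment> \<open>\<open>v\<close> lies in the first clique and brings in at most two vertices
      of the second, so the union has at most (n - 3) + 2 elements.\<close>
    then have "nbrs ?V ?E u \<union> nbrs ?V ?E v \<subseteq> A \<union> ?S" using nA[of v] v by blast
    then have "card (nbrs ?V ?E u \<union> nbrs ?V ?E v) \<le> card (A \<union> ?S)" using V(5) by (intro card_mono) auto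
    also have "\<dots> \<le> card A + card ?S" by (rule card_Un_le)
    finally show "card (nbrs ?V ?E u \<union> nbrs ?V ?E v) < n" using c2 V(3) assms(1) by linarith
  qed
qed

section \<open>The exact value at residue n - 8\<close>

lemma deficit_eq:
  assumes "simple_graph V E"
  shows "deficit n V E = (int n - 2) * int (card V) - 2 * int (card E)"
proof -
  have "(\<Sum>v\<in>V. int (deg V E v)) = 2 * int (card E)"
    using arg_cong[OF degree_sum[OF assms], of int] by simp
  then show ?thesis by (simp add: deficit_def sum_subtractf)
qed

text \<open>The equation is doubled and read over the integers, which avoids halving and truncated
  subtraction.\<close>

theorem theorem4p4:
  fixes p n k :: nat
  assumes "n \<ge> 15" and "p \<ge> n" and "k \<ge> 1"
    and "p = k * (n - 1) + n - 8"
  shows "2 * int (ex p {0..<n} (T3 n))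
           = (int n - 2) * int p - 7 * int n + 30 + 2 * max (int n div 2) 13"
    (is "_ = ?rhs")
proof -
  let ?Gs = "{E. simple_graph {0..<p} E \<and> \<not> contains_copy {0..<n} (T3 n) {0..<p} E}"
  have n6: "6 \<le> n" and n1: "1 \<le> n" using assms(1) by simp_all
  have p: "p = n - 8 + k * (n - 1)" using assms(1,4) by simp
  obtain q where q: "k = Suc q" using assms(3) by (cases k) auto
  have ip: "int p = int n - 8 + int k * (int n - 1)" using assms(1) unfolding p by (simp add: of_nat_diff)
  have upper: "2 * int (card E) \<le> ?rhs" if "E \<in> ?Gs" for E
  proof -
    have sg: "simple_graph {0..<p} E" and nc: "\<not> contains_copy {0..<n} (T3 n) {0..<p} E"
      using that by auto
    then have E2: "\<forall>e\<in>E. card e = 2" by (auto simp: simple_graph_def)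
    have jb: "joint_bounded n {0..<p} E"
      using copy_if_not_joint_bounded[OF n6 _ E2] nc by blast
    have "p mod (n - 1) = (n - 8) mod (n - 1)" unfolding p by (rule mod_mult_self1)
    then have "p mod (n - 1) = n - 8" using assms(1) by simp
    then have "bound n p = tau n"
      using assms(1) by (simp add: bound_def psi_def tau_def of_nat_diff)
    moreover have "bound n p \<le> deficit n {0..<p} E"
      using deficit_ge_bound[OF assms(1) _ E2 jb] by simp
    ultimately have low: "tau n \<le> (int n - 2) * int p - 2 * int (card E)"
      unfolding deficit_eq[OF sg] by simp
    show ?thesis
    proof (cases "even n")
      case True
      then have "2 * (int n div 2) = int n" by simp
      then show ?thesis using low unfolding tau_def by linarith
    next
      case False
      \<comment> \<open>For odd n the deficit is odd and cannot equal 6n - 30; the extra 1 makes up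
        for rounding down n / 2.\<close>
      then have "odd (int n - 2)" "odd (int p)" unfolding ip by simp_all
      then have "odd ((int n - 2) * int p - 2 * int (card E))" by simp
      moreover have "even (6 * int n - 30)" by simp
      ultimately have "(int n - 2) * int p - 2 * int (card E) \<noteq> 6 * int n - 30" by metis
      moreover have "2 * (int n div 2) = int n - 1" using False by (elim oddE) simp
      ultimately show ?thesis using low unfolding tau_def by linarith
    qed
  qed
  have attained: "\<exists>E\<in>?Gs. 2 * int (card E) = ?rhs"
  proof (cases "int n div 2 \<le> 13")
    case True
    have "simple_graph {} ({} :: nat set set)" "joint_bounded n {} ({} :: nat set set)"
      by (auto simp: simple_graph_def joint_bounded_def)
    then have base: "simple_graph {0..<n - 8} (pairs {0..<n - 8})"
      "joint_bounded n {0..<n - 8} (pairs {0..<n - 8})"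
      using disjoint_clique(1,2)[of "{}" "{}" n "{0..<n - 8}"] assms(1) by simp_all
    obtain E where E: "simple_graph {0..<p} E" "joint_bounded n {0..<p} E"
      "2 * int (card E) = 2 * int (card (pairs {0..<n - 8})) + int k * (int n - 1) * (int n - 2)"
      using add_cliques[OF base n1, of k, folded p] by blast
    have "2 * int (card (pairs {0..<n - 8})) = (int n - 8) * (int n - 9)"
      using card_pairs[of "{0..<n - 8}"] assms(1) by (simp add: of_nat_diff)
    then have "2 * int (card E) = ?rhs" using E(3) True unfolding ip by (simp add: max_def algebra_simps)
    moreover have "E \<in> ?Gs" using E not_joint_bounded_if_copy[OF n6] by blast
    ultimately show ?thesis by blast
  next
    case False
    \<comment> \<open>The block of order 2n - 9 = (n - 8) + (n - 1) uses up one clique, leaving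
      \<open>q\<close> of the \<open>k\<close>.\<close>
    have pq: "p = 2 * n - 9 + q * (n - 1)" using assms(1) unfolding p q by simp
    note H = two_block_bounds[OF assms(1) refl]
    obtain E where E: "simple_graph {0..<p} E" "joint_bounded n {0..<p} E"
      "2 * int (card E) = 2 * int (card (two_block n ((n - 6) div 2))) + int q * (int n - 1) * (int n - 2)"
      using add_cliques[OF H(1,2) n1, of q, folded pq] by blast
    have "2 * int (card E) = ?rhs"
      using E(3) False unfolding H(3) ip q by (simp add: max_def algebra_simps zdiv_int)
    moreover have "E \<in> ?Gs" using E not_joint_bounded_if_copy[OF n6] by blast
    ultimately show ?thesis by blast
  qed
  then obtain E0 where E0: "E0 \<in> ?Gs" "2 * int (card E0) = ?rhs" by blast
  have "?Gs \<subseteq> Pow (Pow {0..<p})" by (auto simp: simple_graph_def)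
  then have "finite ?Gs" by (rule finite_subset) simp
  moreover have "card E \<le> card E0" if "E \<in> ?Gs" for E using upper[OF that] E0(2) by linarith
  moreover have "{card E | E. E \<in> ?Gs} = card ` ?Gs" by auto
  ultimately have "Max {card E | E. E \<in> ?Gs} = card E0" using E0(1) by (intro Max_eqI) auto
  then show ?thesis using E0(2) by (simp add: ex_def)
qed

end
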